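(* Let $G\in C^2(\mathbb{R}^N;\mathbb{R})$ and $\gamma>0$. Define $\mathcal{F}:\mathbb{R}^N\times\mathbb{R}^N\to\mathbb{R}^N\times\mathbb{R}^N$ by $\mathcal{F}(u,v)=(-v,\ \gamma v+\nabla G(u))$ and, for $\lambda\ge0$, define $\mathcal{E}_\lambda\in C^1(\mathbb{R}^N\times\mathbb{R}^N;\mathbb{R})$ by $$\mathcal{E}_\lambda(u,v)=\Big(\tfrac12\|v\|^2+G(u)\Big)+\lambda\langle\nabla G(u),v\rangle.$$ Then for every $R>0$ there exists $\lambda_0>0$ such that the following holds. For every $\lambda\in(0,\lambda_0]$ there exists $\alpha>0$ such that $$\langle\nabla\mathcal{E}_\lambda(u,v),\mathcal{F}(u,v)\rangle\ge\alpha\,\|\nabla\mathcal{E}_\lambda(u,v)\|\,\|\mathcal{F}(u,v)\|\quad\text{for every }(u,v)\in\overline B(0,R)\times\mathbb{R}^N.$$ Furthermore, $$\operatorname{crit}\mathcal{E}_\lambda\cap\big(\overline B(0,R)\times\mathbb{R}^N\big)=\mathcal{F}^{-1}(\{0\})\cap\big(\overline B(0,R)\times\mathbb{R}^N\big)\quad\text{for every }\lambda\in[0,\lambda_0].$$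
   Context: $\mathbb{R}^N$ and $\mathbb{R}^N\times\mathbb{R}^N$ carry the Euclidean scalar product and norm; $\overline B(0,R)$ is the closed ball in $\mathbb{R}^N$; $\operatorname{crit}\mathcal{E}_\lambda=\{\nabla\mathcal{E}_\lambda=0\}$. (The second order equation $u''+\gamma u'+\nabla G(u)=0$ is equivalent to $U'+\mathcal{F}(U)=0$ with $U=(u,u')$.) *)

theory Defs
  imports "HOL-Analysis.Analysis"
begin

text \<open>Continuous differentiability on the whole space. The derivative is taken as a map into the
  space of bounded linear maps with the operator norm, so that it can be differentiated again.\<close>

definition C1 :: "('a::real_normed_vector \<Rightarrow> 'b::real_normed_vector) \<Rightarrow> bool" where
  "C1 f \<longleftrightarrow> (\<exists>f' :: 'a \<Rightarrow> 'a \<Rightarrow>\<^sub>L 'b.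
     (\<forall>x. (f has_derivative blinfun_apply (f' x)) (at x)) \<and> continuous_on UNIV f')"

definition C2 :: "('a::real_normed_vector \<Rightarrow> 'b::real_normed_vector) \<Rightarrow> bool" where
  "C2 f \<longleftrightarrow> (\<exists>f' :: 'a \<Rightarrow> 'a \<Rightarrow>\<^sub>L 'b.
     (\<forall>x. (f has_derivative blinfun_apply (f' x)) (at x)) \<and> C1 f')"

text \<open>Meaningful only where \<open>f\<close> is differentiable; elsewhere the value is unspecified.\<close>

definition grad :: "('a::real_inner \<Rightarrow> real) \<Rightarrow> 'a \<Rightarrow> 'a" where
  "grad f x = (THE D. GDERIV f x :> D)"

lemma grad_eqI:
  assumes "GDERIV f x :> D"
  shows "grad f x = D"
  unfolding grad_def
proof (rule the_equality)
  fix D' assume "GDERIV f x :> D'"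
  with assms have "(\<lambda>h. h \<bullet> D') = (\<lambda>h. h \<bullet> D)"
    unfolding gderiv_def by (metis has_derivative_unique)
  then show "D' = D"
    by (metis vector_eq_ldot inner_commute)
qed (fact assms)

lemma GDERIV_grad:
  fixes f :: "'a::euclidean_space \<Rightarrow> real"
  assumes "f differentiable (at x)"
  shows "GDERIV f x :> grad f x"
proof -
  obtain f' where f': "(f has_derivative f') (at x)"
    using assms unfolding differentiable_def by blast
  then interpret bounded_linear f'
    by (rule has_derivative_bounded_linear)
  have "f' = (\<lambda>h. h \<bullet> adjoint f' 1)"
    using adjoint_works[OF linear_axioms, of _ 1] by auto
  with f' have "GDERIV f x :> adjoint f' 1"
    unfolding gderiv_def by metis
  with grad_eqI show ?thesis
    by metis
qed

definition crit :: "('a::real_inner \<Rightarrow> real) \<Rightarrow> 'a set" where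
  "crit f = {x. grad f x = 0}"

definition vfield :: "real \<Rightarrow> ('a::real_inner \<Rightarrow> real) \<Rightarrow> 'a \<times> 'a \<Rightarrow> 'a \<times> 'a" where
  "vfield \<gamma> G = (\<lambda>(u, v). (- v, \<gamma> *\<^sub>R v + grad G u))"

definition energy :: "('a::real_inner \<Rightarrow> real) \<Rightarrow> real \<Rightarrow> 'a \<times> 'a \<Rightarrow> real" where
  "energy G lam = (\<lambda>(u, v). ((norm v)\<^sup>2 / 2 + G u) + lam * (grad G u \<bullet> v))"

end

theory Submission
  imports Defs
begin

text \<open>Write \<open>g = \<nabla>G(u)\<close> and \<open>A\<close> for the Hessian of \<open>G\<close> at \<open>u\<close>. Then
  \<open>\<nabla>E = (g + \<lambda> A v, v + \<lambda> g)\<close>, so the two terms \<open>\<langle>g, v\<rangle>\<close> in the product with \<open>F = (- v, \<gamma> v + g)\<close>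
  cancel and
  \<open>\<langle>\<nabla>E, F\<rangle> = \<gamma> \<parallel>v\<parallel>\<^sup>2 + \<lambda> \<gamma> \<langle>g, v\<rangle> + \<lambda> \<parallel>g\<parallel>\<^sup>2 - \<lambda> \<langle>A v, v\<rangle>\<close>.
  As \<open>A\<close> is bounded over the ball, for small \<open>\<lambda>\<close> this dominates a multiple of
  \<open>\<parallel>v\<parallel>\<^sup>2 + \<parallel>g\<parallel>\<^sup>2\<close>, while \<open>\<parallel>\<nabla>E\<parallel>\<close> and \<open>\<parallel>F\<parallel>\<close> are at most multiples of \<open>\<parallel>v\<parallel> + \<parallel>g\<parallel>\<close>.\<close>

section \<open>Derivative and regularity of the energy\<close>

lemma has_derivative_imp_inner_grad:
  fixes f :: "'a::euclidean_space \<Rightarrow> real"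
  assumes "(f has_derivative f') (at x)"
  shows "grad f x \<bullet> h = f' h"
proof -
  have "GDERIV f x :> grad f x"
    using assms GDERIV_grad differentiable_def by blast
  then have "(\<lambda>h. h \<bullet> grad f x) = f'"
    unfolding gderiv_def using assms has_derivative_unique by blast
  then show ?thesis
    by (metis inner_commute)
qed

lemma C2E:
  fixes G :: "'a::euclidean_space \<Rightarrow> real"
  assumes "C2 G"
  obtains G' :: "'a \<Rightarrow> 'a \<Rightarrow>\<^sub>L real" and G'' :: "'a \<Rightarrow> 'a \<Rightarrow>\<^sub>L 'a \<Rightarrow>\<^sub>L real"
  where "\<And>x. (G has_derivative blinfun_apply (G' x)) (at x)"
    and "\<And>x. (G' has_derivative blinfun_apply (G'' x)) (at x)"
    and "continuous_on UNIV G''"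
  using assms unfolding C2_def C1_def by metis

text \<open>The only term that needs the second derivative is the pairing of \<open>grad G u\<close>
  with \<open>v\<close>. Read as the operator \<open>G' u\<close> applied to \<open>v\<close>, it
  falls under the product rule for the bilinear application map, and the Hessian enters as the
  bilinear form \<open>G'' u\<close>.\<close>

lemma has_derivative_energy:
  fixes G :: "'a::euclidean_space \<Rightarrow> real" and G' :: "'a \<Rightarrow> 'a \<Rightarrow>\<^sub>L real"
  assumes G': "\<And>x. (G has_derivative blinfun_apply (G' x)) (at x)"
    and G'': "\<And>x. (G' has_derivative blinfun_apply (G'' x)) (at x)"
  shows "(energy G lam has_derivative
    (\<lambda>h. v \<bullet> snd h + grad G u \<bullet> fst h
      + lam * (blinfun_apply (G'' u (fst h)) v + grad G u \<bullet> snd h))) (at (u, v))"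
proof -
  have grad: "grad G x \<bullet> h = blinfun_apply (G' x) h" for x h
    using G' has_derivative_imp_inner_grad by blast
  have energy: "energy G lam = (\<lambda>p. snd p \<bullet> snd p / 2 + G (fst p) + lam * blinfun_apply (G' (fst p)) (snd p))"
    by (auto simp: energy_def grad power2_norm_eq_inner)
  have fst: "(fst has_derivative fst) (at (u, v))" and snd: "(snd has_derivative snd) (at (u, v))"
    by (auto intro: derivative_eq_intros)
  have 1: "((\<lambda>p. G (fst p)) has_derivative (\<lambda>h. blinfun_apply (G' u) (fst h))) (at (u, v))"
    using has_derivative_compose[OF fst, of G "blinfun_apply (G' u)"] G' by simp
  have 2: "((\<lambda>p. G' (fst p)) has_derivative (\<lambda>h. blinfun_apply (G'' u) (fst h))) (at (u, v))"
    using has_derivative_compose[OF fst, of G' "blinfun_apply (G'' u)"] G'' by simp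
  have 3: "((\<lambda>p. blinfun_apply (G' (fst p)) (snd p)) has_derivative
     (\<lambda>h. blinfun_apply (G' u) (snd h) + blinfun_apply (blinfun_apply (G'' u) (fst h)) v)) (at (u, v))"
    using bounded_bilinear.FDERIV[OF bounded_bilinear_blinfun_apply 2 snd] by simp
  have 4: "((\<lambda>p. snd p \<bullet> snd p / 2) has_derivative (\<lambda>h. v \<bullet> snd h)) (at (u, v))"
    using has_derivative_mult_right[OF has_derivative_inner[OF snd snd], of "1 / 2"]
    by (simp add: inner_commute)
  show ?thesis
    unfolding energy grad
    by (rule has_derivative_eq_rhs[OF has_derivative_add[OF has_derivative_add[OF 4 1]
          has_derivative_mult_right[OF 3]]])
      (auto simp: algebra_simps)
qed

lemma C1_energy:
  fixes G :: "'a::euclidean_space \<Rightarrow> real"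
  assumes "C2 G"
  shows "C1 (energy G lam)"
proof -
  obtain G' :: "'a \<Rightarrow> 'a \<Rightarrow>\<^sub>L real" and G'' where
    G': "\<And>x. (G has_derivative blinfun_apply (G' x)) (at x)"
    and G'': "\<And>x. (G' has_derivative blinfun_apply (G'' x)) (at x)"
    and cont: "continuous_on UNIV G''"
    using C2E[OF assms] by blast
  have grad: "grad G x \<bullet> h = blinfun_apply (G' x) h" for x h
    using G' has_derivative_imp_inner_grad by blast
  define E where "E p h = snd p \<bullet> snd h + grad G (fst p) \<bullet> fst h
      + lam * (blinfun_apply (G'' (fst p) (fst h)) (snd p) + grad G (fst p) \<bullet> snd h)" for p h
  have deriv: "(energy G lam has_derivative E p) (at p)" for p
    using has_derivative_energy[OF G' G'', of lam "snd p" "fst p"]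
    by (simp add: E_def[abs_def])
  then have blinfun: "blinfun_apply (Blinfun (E p)) = E p" for p
    using bounded_linear_Blinfun_apply has_derivative_bounded_linear by blast
  have contG': "continuous_on UNIV G'"
    using G'' has_derivative_continuous continuous_at_imp_continuous_on by blast
  have "continuous_on UNIV (\<lambda>p. E p h)" for h
    unfolding E_def grad
    by (intro continuous_intros continuous_on_compose2[OF cont] continuous_on_compose2[OF contG'])
      auto
  then have "continuous_on UNIV (\<lambda>p. Blinfun (E p))"
    \<comment> \<open>The domain is finite-dimensional, so continuity in each fixed direction
      \<open>h\<close> gives continuity in the operator norm.\<close>
    by (intro continuous_on_blinfun_componentwise) (simp add: blinfun)
  with deriv blinfun show ?thesis
    unfolding C1_def by metis
qed

text \<open>Testing the gradient against a direction keeps the Hessian a bilinear form, so all later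
  estimates avoid an explicit vector for the gradient.\<close>

lemma inner_grad_energy:
  fixes G :: "'a::euclidean_space \<Rightarrow> real"
  assumes "\<And>x. (G has_derivative blinfun_apply (G' x)) (at x)"
    and "\<And>x. (G' has_derivative blinfun_apply (G'' x)) (at x)"
  shows "grad (energy G lam) (u, v) \<bullet> (h, k) = v \<bullet> k + grad G u \<bullet> h
      + lam * (blinfun_apply (G'' u h) v + grad G u \<bullet> k)"
  using has_derivative_imp_inner_grad[OF has_derivative_energy[OF assms, of lam v u], of "(h, k)"]
  by simp

section \<open>Pointwise estimates for the gradient of the energy and the vector field\<close>

lemma inner_grad_energy_vfield_ge:
  fixes G :: "'a::euclidean_space \<Rightarrow> real" and \<gamma> lam M :: real
  assumes G': "\<And>x. (G has_derivative blinfun_apply (G' x)) (at x)"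
    and G'': "\<And>x. (G' has_derivative blinfun_apply (G'' x)) (at x)"
    and M: "norm (G'' u) \<le> M" and lam: "0 \<le> lam" "lam * (M + \<gamma>\<^sup>2 / 2) \<le> \<gamma> / 2"
  shows "min \<gamma> lam / 2 * ((norm v)\<^sup>2 + (norm (grad G u))\<^sup>2)
    \<le> grad (energy G lam) (u, v) \<bullet> vfield \<gamma> G (u, v)"
proof -
  define g where "g = grad G u"
  have "blinfun_apply (G'' u v) v \<le> norm (G'' u v) * norm v"
    using norm_blinfun[of "G'' u v" v] by simp
  also have "\<dots> \<le> norm (G'' u) * norm v * norm v"
    by (intro mult_right_mono norm_blinfun) auto
  also have "\<dots> \<le> M * (norm v)\<^sup>2"
    using M by (simp add: power2_eq_square mult.assoc mult_right_mono)
  finally have 1: "lam * blinfun_apply (G'' u v) v \<le> lam * M * (norm v)\<^sup>2"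
    using lam(1) by (simp add: mult_left_mono mult.assoc)
  \<comment> \<open>Young's inequality for the cross term, weighted to cost only half of the
    available \<open>lam * norm g ^ 2\<close>. The price in \<open>v\<close> is
    \<open>lam * \<gamma>^2 / 2\<close>. Together with the Hessian term \<open>lam * M\<close> it
    uses at most half of the damping \<open>\<gamma>\<close>, which is the smallness condition on
    \<open>lam\<close>.\<close>
  have "0 \<le> (norm (g + \<gamma> *\<^sub>R v))\<^sup>2"
    by simp
  also have "\<dots> = (norm g)\<^sup>2 + 2 * \<gamma> * (g \<bullet> v) + \<gamma>\<^sup>2 * (norm v)\<^sup>2"
    unfolding power2_norm_eq_inner
    by (simp add: inner_add_left inner_add_right inner_commute algebra_simps power2_eq_square)
  finally have "0 \<le> lam * ((norm g)\<^sup>2 + 2 * \<gamma> * (g \<bullet> v) + \<gamma>\<^sup>2 * (norm v)\<^sup>2)"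
    using lam(1) by simp
  then have 2: "- lam * \<gamma> * (g \<bullet> v) \<le> lam / 2 * (norm g)\<^sup>2 + lam * \<gamma>\<^sup>2 / 2 * (norm v)\<^sup>2"
    by (simp add: algebra_simps)
  have 3: "lam * (M + \<gamma>\<^sup>2 / 2) * (norm v)\<^sup>2 \<le> \<gamma> / 2 * (norm v)\<^sup>2"
    using lam(2) by (intro mult_right_mono) auto
  have "min \<gamma> lam / 2 * ((norm v)\<^sup>2 + (norm g)\<^sup>2)
      = min \<gamma> lam / 2 * (norm v)\<^sup>2 + min \<gamma> lam / 2 * (norm g)\<^sup>2"
    by (simp add: distrib_left)
  also have "\<dots> \<le> \<gamma> / 2 * (norm v)\<^sup>2 + lam / 2 * (norm g)\<^sup>2"
    by (intro add_mono mult_right_mono) auto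
  also have "\<dots> \<le> \<gamma> * (norm v)\<^sup>2 + lam * \<gamma> * (g \<bullet> v) + lam * (norm g)\<^sup>2
      - lam * blinfun_apply (G'' u v) v"
    using 1 2 3 by (simp add: algebra_simps)
  also have "\<dots> = grad (energy G lam) (u, v) \<bullet> vfield \<gamma> G (u, v)"
    by (simp add: vfield_def inner_grad_energy[OF G' G''] g_def power2_norm_eq_inner
        blinfun.minus_left blinfun.minus_right inner_add_right inner_commute algebra_simps)
  finally show ?thesis
    by (simp add: g_def)
qed

text \<open>The gradient \<open>D\<close> is paired with itself: every term of the resulting formula
  carries a factor at most \<open>norm D\<close>, which is then divided out.\<close>

lemma norm_grad_energy_le:
  fixes G :: "'a::euclidean_space \<Rightarrow> real" and lam M :: real
  assumes G': "\<And>x. (G has_derivative blinfun_apply (G' x)) (at x)"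
    and G'': "\<And>x. (G' has_derivative blinfun_apply (G'' x)) (at x)"
    and M: "norm (G'' u) \<le> M" and lam: "0 \<le> lam"
  shows "norm (grad (energy G lam) (u, v)) \<le> (1 + lam + lam * M) * (norm v + norm (grad G u))"
proof -
  define g where "g = grad G u"
  define D where "D = grad (energy G lam) (u, v)"
  obtain h k where hk: "D = (h, k)"
    by (cases D)
  have h: "norm h \<le> norm D" and k: "norm k \<le> norm D"
    using norm_fst_le[of h k] norm_snd_le[of k h] by (auto simp: hk)
  have M0: "0 \<le> M"
    using M norm_ge_zero order_trans by blast
  have "blinfun_apply (G'' u h) v \<le> norm (G'' u h) * norm v"
    using norm_blinfun[of "G'' u h" v] by simp
  also have "\<dots> \<le> norm (G'' u) * norm h * norm v"
    by (intro mult_right_mono norm_blinfun) auto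
  also have "\<dots> \<le> M * norm D * norm v"
    using M M0 h by (intro mult_right_mono mult_mono) auto
  finally have 1: "blinfun_apply (G'' u h) v \<le> M * norm D * norm v" .
  have 2: "x \<bullet> y \<le> norm x * norm D" if "norm y \<le> norm D" for x y :: 'a
    using norm_cauchy_schwarz[of x y] mult_left_mono[OF that norm_ge_zero[of x]] by linarith
  have "norm D * norm D = D \<bullet> D"
    by (simp add: norm_eq_sqrt_inner)
  also have "\<dots> = v \<bullet> k + g \<bullet> h + lam * (blinfun_apply (G'' u h) v + g \<bullet> k)"
    using inner_grad_energy[OF G' G'', of lam u v h k] by (simp add: D_def[symmetric] hk g_def)
  also have "\<dots> \<le> norm v * norm D + norm g * norm D
      + lam * (M * norm D * norm v + norm g * norm D)"
    using lam by (intro add_mono mult_left_mono 1 2 h k) auto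
  also have "\<dots> = (norm v + norm g + lam * M * norm v + lam * norm g) * norm D"
    by (simp add: algebra_simps)
  finally have "norm D \<le> norm v + norm g + lam * M * norm v + lam * norm g"
    by (cases "norm D = 0") (use lam M0 in \<open>auto simp: mult_le_cancel_right\<close>)
  \<comment> \<open>The added nonnegative terms are those missing for the sum to factor.\<close>
  also have "\<dots> \<le> norm v + norm g + lam * M * norm v + lam * norm g
      + (lam * norm v + lam * M * norm g)"
    using lam M0 by simp
  also have "\<dots> = (1 + lam + lam * M) * (norm v + norm g)"
    by (simp add: algebra_simps)
  finally show ?thesis
    by (simp add: D_def g_def)
qed

lemma norm_vfield_le:
  assumes "\<gamma> \<ge> 0"
  shows "norm (vfield \<gamma> G (u, v)) \<le> (1 + \<gamma>) * (norm v + norm (grad G u))"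
proof -
  have "norm (vfield \<gamma> G (u, v)) \<le> norm v + norm (\<gamma> *\<^sub>R v + grad G u)"
    using norm_Pair_le[of "- v" "\<gamma> *\<^sub>R v + grad G u"] by (simp add: vfield_def)
  also have "\<dots> \<le> norm v + (\<gamma> * norm v + norm (grad G u))"
    using norm_triangle_ineq[of "\<gamma> *\<^sub>R v" "grad G u"] assms by simp
  also have "\<dots> \<le> (1 + \<gamma>) * (norm v + norm (grad G u))"
    using assms by (simp add: algebra_simps)
  finally show ?thesis .
qed

lemma vfield_eq_0_iff: "vfield \<gamma> G (u, v) = 0 \<longleftrightarrow> v = 0 \<and> grad G u = 0"
  by (auto simp: vfield_def zero_prod_def)

theorem proposition3p9:
  fixes G :: "real ^ 'n \<Rightarrow> real" and \<gamma> :: real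
  assumes "C2 G" and "\<gamma> > 0"
  shows "(\<forall>lam\<ge>0. C1 (energy G lam)) \<and>
    (\<forall>R>0. \<exists>lam0>0.
      (\<forall>lam\<in>{0<..lam0}. \<exists>\<alpha>>0. \<forall>(u, v) \<in> cball 0 R \<times> UNIV.
         grad (energy G lam) (u, v) \<bullet> vfield \<gamma> G (u, v)
           \<ge> \<alpha> * norm (grad (energy G lam) (u, v)) * norm (vfield \<gamma> G (u, v))) \<and>
      (\<forall>lam\<in>{0..lam0}. crit (energy G lam) \<inter> (cball 0 R \<times> UNIV)
         = vfield \<gamma> G -` {0} \<inter> (cball 0 R \<times> UNIV)))"
proof (intro conjI allI impI)
  show "C1 (energy G lam)" for lam
    using C1_energy assms(1) .
next
  fix R :: real
  obtain G' :: "real ^ 'n \<Rightarrow> (real ^ 'n) \<Rightarrow>\<^sub>L real" and G'' where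
    G': "\<And>x. (G has_derivative blinfun_apply (G' x)) (at x)"
    and G'': "\<And>x. (G' has_derivative blinfun_apply (G'' x)) (at x)"
    and cont: "continuous_on UNIV G''"
    using C2E[OF assms(1)] by blast
  \<comment> \<open>Although \<open>v\<close> is unrestricted, the Hessian depends on
    \<open>u\<close> alone, so compactness of the ball gives one bound \<open>M\<close> for all
    points considered.\<close>
  have "bounded (G'' ` cball 0 R)"
    using cont by (intro compact_imp_bounded compact_continuous_image)
      (auto intro: continuous_on_subset)
  then obtain M where M0: "M > 0" and M: "\<And>u. u \<in> cball 0 R \<Longrightarrow> norm (G'' u) \<le> M"
    unfolding bounded_pos by blast
  \<comment> \<open>The largest \<open>lam\<close> that the smallness condition of the lower bound
    permits.\<close>
  define lam0 where "lam0 = \<gamma> / 2 / (M + \<gamma>\<^sup>2 / 2)"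
  have den: "M + \<gamma>\<^sup>2 / 2 > 0"
    using M0 by (simp add: add_pos_nonneg)
  have lam0: "lam * (M + \<gamma>\<^sup>2 / 2) \<le> \<gamma> / 2" if "lam \<le> lam0" for lam
    using that pos_le_divide_eq[OF den] unfolding lam0_def by blast
  have lower: "min \<gamma> lam / 2 * ((norm v)\<^sup>2 + (norm (grad G u))\<^sup>2)
      \<le> grad (energy G lam) (u, v) \<bullet> vfield \<gamma> G (u, v)"
    if "u \<in> cball 0 R" "0 \<le> lam" "lam \<le> lam0" for u v lam
    using inner_grad_energy_vfield_ge[OF G' G'' M[OF that(1)] that(2) lam0[OF that(3)]] .
  have upper: "norm (grad (energy G lam) (u, v)) \<le> (1 + lam + lam * M) * (norm v + norm (grad G u))"
    if "u \<in> cball 0 R" "0 \<le> lam" for u v lam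
    using norm_grad_energy_le[OF G' G'' M[OF that(1)] that(2)] .
  show "\<exists>lam0>0.
      (\<forall>lam\<in>{0<..lam0}. \<exists>\<alpha>>0. \<forall>(u, v) \<in> cball 0 R \<times> UNIV.
         grad (energy G lam) (u, v) \<bullet> vfield \<gamma> G (u, v)
           \<ge> \<alpha> * norm (grad (energy G lam) (u, v)) * norm (vfield \<gamma> G (u, v))) \<and>
      (\<forall>lam\<in>{0..lam0}. crit (energy G lam) \<inter> (cball 0 R \<times> UNIV)
         = vfield \<gamma> G -` {0} \<inter> (cball 0 R \<times> UNIV))"
  proof (rule exI[of _ lam0], intro conjI ballI)
    show "lam0 > 0"
      using den assms(2) by (simp add: lam0_def)
  next
    fix lam assume "lam \<in> {0<..lam0}"
    then have lam: "0 < lam" "lam \<le> lam0"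
      by auto
    define K where "K = (1 + lam + lam * M) * (1 + \<gamma>)"
    have K: "K > 0"
      unfolding K_def using lam M0 assms(2) by (intro mult_pos_pos add_pos_nonneg) auto
    \<comment> \<open>The ratio of the lower bound's constant to that of the upper bound on the
      product of norms: \<open>K\<close> multiplies the two norm constants, and the factor 2 comes
      from \<open>(a + b)^2 \<le> 2 * (a^2 + b^2)\<close>.\<close>
    define \<alpha> where "\<alpha> = min \<gamma> lam / 2 / (2 * K)"
    have \<alpha>: "\<alpha> > 0" and \<alpha>K: "\<alpha> * (2 * K) = min \<gamma> lam / 2"
      using K lam assms(2) by (auto simp: \<alpha>_def)
    have "\<alpha> * norm (grad (energy G lam) (u, v)) * norm (vfield \<gamma> G (u, v))
        \<le> grad (energy G lam) (u, v) \<bullet> vfield \<gamma> G (u, v)" if u: "u \<in> cball 0 R" for u v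
    proof -
      define a b where "a = norm v" and "b = norm (grad G u)"
      have "norm (grad (energy G lam) (u, v)) * norm (vfield \<gamma> G (u, v))
          \<le> ((1 + lam + lam * M) * (a + b)) * ((1 + \<gamma>) * (a + b))"
        unfolding a_def b_def using lam M0 assms(2)
        by (intro mult_mono upper norm_vfield_le u) auto
      also have "\<dots> = K * (a + b)\<^sup>2"
        by (simp add: K_def power2_eq_square)
      also have "\<dots> \<le> K * (2 * (a\<^sup>2 + b\<^sup>2))"
        using K sum_squares_bound[of a b] by (simp add: power2_sum)
      finally have "\<alpha> * (norm (grad (energy G lam) (u, v)) * norm (vfield \<gamma> G (u, v)))
          \<le> \<alpha> * (K * (2 * (a\<^sup>2 + b\<^sup>2)))"
        using \<alpha> by (simp add: mult_left_mono)
      also have "\<dots> = min \<gamma> lam / 2 * (a\<^sup>2 + b\<^sup>2)"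
        by (simp add: \<alpha>K[symmetric])
      also have "\<dots> \<le> grad (energy G lam) (u, v) \<bullet> vfield \<gamma> G (u, v)"
        unfolding a_def b_def using lower u lam by simp
      finally show ?thesis
        by (simp add: mult.assoc)
    qed
    with \<alpha> show "\<exists>\<alpha>>0. \<forall>(u, v) \<in> cball 0 R \<times> UNIV.
         grad (energy G lam) (u, v) \<bullet> vfield \<gamma> G (u, v)
           \<ge> \<alpha> * norm (grad (energy G lam) (u, v)) * norm (vfield \<gamma> G (u, v))"
      by auto
  next
    fix lam assume "lam \<in> {0..lam0}"
    then have lam: "0 \<le> lam" "lam \<le> lam0"
      by auto
    have "grad (energy G lam) (u, v) = 0 \<longleftrightarrow> vfield \<gamma> G (u, v) = 0" if u: "u \<in> cball 0 R" for u v
    proof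
      assume "vfield \<gamma> G (u, v) = 0"
      then show "grad (energy G lam) (u, v) = 0"
        using upper[OF u lam(1), of v] by (simp add: vfield_eq_0_iff)
    next
      assume crit: "grad (energy G lam) (u, v) = 0"
      show "vfield \<gamma> G (u, v) = 0"
      \<comment> \<open>At \<open>lam = 0\<close> the constant \<open>min \<gamma> lam / 2\<close>
        vanishes and the lower bound is empty, so the gradient formula is used directly.\<close>
      proof (cases "lam = 0")
        case True
        with crit have "v \<bullet> k + grad G u \<bullet> h = 0" for h k
          using inner_grad_energy[OF G' G'', of 0 u v h k] by simp
        \<comment> \<open>The choice \<open>k = v\<close>, \<open>h = grad G u\<close> makes the sum
          of both squared norms zero; \<open>k = v\<close>, \<open>h = 0\<close> isolates
          \<open>v\<close>.\<close>
        from this[of v "grad G u"] this[of v 0] show ?thesis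
          by (simp add: vfield_eq_0_iff)
      next
        case False
        then have "min \<gamma> lam / 2 > 0"
          using lam assms(2) by simp
        moreover have "min \<gamma> lam / 2 * ((norm v)\<^sup>2 + (norm (grad G u))\<^sup>2) \<le> 0"
          using lower[OF u lam, of v] crit by simp
        ultimately have "(norm v)\<^sup>2 + (norm (grad G u))\<^sup>2 \<le> 0"
          using mult_pos_pos not_less by blast
        then show ?thesis
          by (simp add: vfield_eq_0_iff sum_power2_le_zero_iff)
      qed
    qed
    then show "crit (energy G lam) \<inter> (cball 0 R \<times> UNIV)
         = vfield \<gamma> G -` {0} \<inter> (cball 0 R \<times> UNIV)"
      by (auto simp: crit_def)
  qed
qed

end
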